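(* Let $X$ and $Y$ be Banach spaces (over the same scalar field, $\mathbb{R}$ or $\mathbb{C}$), and let $\Gamma \subseteq X \times Y$ be a closed linear relation, i.e. a linear subspace of the Banach space $X \times Y$ that is closed, with $\mathrm{Ran}\,\Gamma = Y$. If $A \subseteq X$ is open, then $A\Gamma \subseteq Y$ is open.
   Context: A linear relation from $X$ to $Y$ is a linear subspace $\Gamma$ of the Banach space $X \times Y$ (with the product topology). For $A \subseteq X$, define $A\Gamma = \{ y \in Y : \exists\, a \in A,\ (a,y) \in \Gamma \} \subseteq Y$. The range of $\Gamma$ is $\mathrm{Ran}\,\Gamma = X\Gamma = \{ y \in Y : \exists\, x \in X,\ (x,y) \in \Gamma \}$. *)

theory Defs
  imports "HOL-Analysis.Analysis"
begin

text \<open>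
  The type classes \<open>real_normed_vector\<close> and \<open>banach\<close> only know real scalars. To treat real and
  complex spaces uniformly, a normed space over a scalar field \<open>'k\<close> is a real normed space together
  with a multiplication by elements of \<open>'k\<close> that extends the real one and makes the norm
  homogeneous. The class \<open>real_normed_field\<close> requires the norm to be multiplicative, so by the
  Gelfand--Mazur theorem its instances are exactly the real and the complex numbers, up to isometric
  isomorphism. Completeness is the type class \<open>banach\<close>; it depends on the norm only.
\<close>

locale normed_space_over = vector_space scale
  for scale :: "'k::real_normed_field \<Rightarrow> 'x::real_normed_vector \<Rightarrow> 'x" +
  assumes scale_of_real: "scale (of_real r) x = r *\<^sub>R x"
    and norm_scale: "norm (scale c x) = norm c * norm x"

definition linear_relation ::
  "('k::real_normed_field \<Rightarrow> 'x::real_normed_vector \<Rightarrow> 'x) \<Rightarrow>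
   ('k \<Rightarrow> 'y::real_normed_vector \<Rightarrow> 'y) \<Rightarrow> ('x \<times> 'y) set \<Rightarrow> bool"
  where "linear_relation sX sY \<Gamma> \<longleftrightarrow> module.subspace (module_prod.scale sX sY) \<Gamma>"

lemma normed_space_over_scaleR:
  "normed_space_over (scaleR :: real \<Rightarrow> 'x \<Rightarrow> 'x::real_normed_vector)"
  by unfold_locales (simp_all add: scaleR_add_right scaleR_add_left)

lemma linear_relation_scaleR: "linear_relation scaleR scaleR \<Gamma> \<longleftrightarrow> subspace \<Gamma>"
  unfolding linear_relation_def module_prod_scale_eq_scaleR subspace_raw_def ..

lemma normed_space_over_complex:
  "normed_space_over ((*) :: complex \<Rightarrow> complex \<Rightarrow> complex)"
  by unfold_locales (simp_all add: algebra_simps norm_mult scaleR_conv_of_real)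

lemma linear_relation_iff:
  assumes "normed_space_over sX" and "normed_space_over sY"
  shows "linear_relation sX sY \<Gamma> \<longleftrightarrow>
    (0, 0) \<in> \<Gamma> \<and>
    (\<forall>x y x' y'. (x, y) \<in> \<Gamma> \<longrightarrow> (x', y') \<in> \<Gamma> \<longrightarrow> (x + x', y + y') \<in> \<Gamma>) \<and>
    (\<forall>c x y. (x, y) \<in> \<Gamma> \<longrightarrow> (sX c x, sY c y) \<in> \<Gamma>)"
proof -
  interpret X: normed_space_over sX by fact
  interpret Y: normed_space_over sY by fact
  interpret P: module_prod sX sY by unfold_locales
  show ?thesis
    unfolding linear_relation_def P.p.subspace_def
    by (auto simp: P.scale_prod zero_prod_def Ball_def split_paired_all)
qed

end

theory Submission
  imports Defs
begin

text \<open>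
  By Baire's theorem some \<open>\<Gamma> `` ball 0 n\<close> is dense in a ball of \<open>Y\<close>, so by linearity every \<open>y\<close> is
  approximated by some \<open>v\<close> with \<open>(x, v) \<in> \<Gamma>\<close> and \<open>\<parallel>x\<parallel> \<le> K \<parallel>y\<parallel>\<close>. Approximating up to half the norm
  and iterating on the remainder gives a series in the closed subspace \<open>\<Gamma>\<close> whose second component
  sums to \<open>y\<close>; hence every \<open>y\<close> has a preimage of norm at most \<open>2 K \<parallel>y\<parallel>\<close>, and openness follows.
\<close>

text \<open>If every \<open>F n\<close> had empty interior, Baire's theorem would make the interior
  of the union empty, whereas the union is the whole space, which is nonempty.\<close>

lemma Baire_UNIV_closed_cover:
  fixes F :: "nat \<Rightarrow> 'a::{complete_space} set"
  assumes "\<And>n. closed (F n)" and "(\<Union>n. F n) = UNIV"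
  obtains n where "interior (F n) \<noteq> {}"
proof -
  have "\<exists>n. interior (F n) \<noteq> {}"
  proof (rule ccontr)
    assume "\<not> ?thesis"
    then have "euclidean interior_of \<Union>(range F) = {}"
      using Met_TC.metric_Baire_category_alt[of "range F"] assms(1)
      by (auto simp: complete_UNIV)
    then show False
      using assms(2) by simp
  qed
  then show thesis
    using that by blast
qed

text \<open>A real scalar r acts on both spaces as \<open>of_real r\<close>, so closure under
  scalars in \<open>'k\<close> restricts to real scalars. The rest of the argument can therefore be
  carried out over the reals.\<close>

lemma linear_relation_subspace:
  assumes "normed_space_over sX" and "normed_space_over sY" and "linear_relation sX sY \<Gamma>"
  shows "subspace \<Gamma>"
proof -
  have "(r *\<^sub>R x, r *\<^sub>R y) \<in> \<Gamma>" if "(x, y) \<in> \<Gamma>" for r x y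
    using assms(3)[unfolded linear_relation_iff[OF assms(1,2)]] that
      normed_space_over.scale_of_real[OF assms(1), of r x]
      normed_space_over.scale_of_real[OF assms(2), of r y]
    by metis
  then show ?thesis
    using assms(3)[unfolded linear_relation_iff[OF assms(1,2)]]
    by (auto simp: subspace_def zero_prod_def)
qed

lemma subspace_approximate_preimage:
  fixes \<Gamma> :: "('x::real_normed_vector \<times> 'y::banach) set"
  assumes "subspace \<Gamma>" and "Range \<Gamma> = UNIV"
  obtains K where "K \<ge> 0"
    and "\<And>y e. e > 0 \<Longrightarrow> \<exists>x v. (x, v) \<in> \<Gamma> \<and> norm x \<le> K * norm y \<and> norm (y - v) \<le> e"
proof -
  have "(\<Union>n. closure (\<Gamma> `` ball 0 (real n))) = UNIV"
  proof -
    have "\<exists>n. y \<in> closure (\<Gamma> `` ball 0 (real n))" for y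
    proof -
      obtain x where "(x, y) \<in> \<Gamma>"
        using assms(2) by blast
      moreover obtain n where "norm x < real n"
        using reals_Archimedean2 by blast
      ultimately have "y \<in> \<Gamma> `` ball 0 (real n)"
        by auto
      then show ?thesis
        using closure_subset by blast
    qed
    then show ?thesis
      by blast
  qed
  then obtain n where "interior (closure (\<Gamma> `` ball 0 (real n))) \<noteq> {}"
    by (rule Baire_UNIV_closed_cover[OF closed_closure])
  \<comment> \<open>A closed ball is chosen because the rescaled vectors used later have norm
    exactly \<open>r\<close>.\<close>
  then obtain c r where r: "r > 0" "cball c r \<subseteq> closure (\<Gamma> `` ball 0 (real n))"
    by (metis all_not_in_conv mem_interior_cball)
  have near: "\<exists>x v. (x, v) \<in> \<Gamma> \<and> norm x < real n \<and> norm (c + u - v) < e"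
    if "norm u \<le> r" "e > 0" for u e
  proof -
    have "c + u \<in> closure (\<Gamma> `` ball 0 (real n))"
      using r that(1) by (auto simp: dist_norm)
    then show ?thesis
      using that(2) by (fastforce simp: closure_approachable dist_norm norm_minus_commute)
  qed
  \<comment> \<open>Approximations of \<open>c + u\<close> and of \<open>c\<close>, each to within
    \<open>e / 2\<close>, are subtracted: this cancels the centre \<open>c\<close>, at the cost of
    doubling the bound on the preimage.\<close>
  have small: "\<exists>x v. (x, v) \<in> \<Gamma> \<and> norm x \<le> 2 * real n \<and> norm (u - v) \<le> e"
    if u: "norm u \<le> r" and e: "e > 0" for u e
  proof -
    obtain x v where xv: "(x, v) \<in> \<Gamma>" "norm x < real n" "norm (c + u - v) < e / 2"
      using near[OF u, of "e / 2"] e by auto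
    obtain x' v' where xv': "(x', v') \<in> \<Gamma>" "norm x' < real n" "norm (c - v') < e / 2"
      using near[of 0 "e / 2"] r e by auto
    have "(x - x', v - v') \<in> \<Gamma>"
      using subspace_diff[OF assms(1) xv(1) xv'(1)] by simp
    moreover have "norm (x - x') \<le> 2 * real n"
      using norm_triangle_ineq4[of x x'] xv(2) xv'(2) by linarith
    moreover have "norm (u - (v - v')) \<le> e"
      using norm_triangle_ineq4[of "c + u - v" "c - v'"] xv(3) xv'(3)
      by (simp add: algebra_simps)
    ultimately show ?thesis
      by blast
  qed
  show thesis
  proof (rule that[of "2 * real n / r"])
    show "0 \<le> 2 * real n / r"
      using r by simp
    fix y :: 'y and e :: real
    assume e: "e > 0"
    show "\<exists>x v. (x, v) \<in> \<Gamma> \<and> norm x \<le> 2 * real n / r * norm y \<and> norm (y - v) \<le> e"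
    proof (cases "y = 0")
      case True
      then show ?thesis
        using subspace_0[OF assms(1)] e by (intro exI[of _ 0]) (auto simp: zero_prod_def)
    next
      case False
      \<comment> \<open>Scaling by \<open>t\<close> moves \<open>y\<close> to the sphere of radius
        \<open>r\<close>, where \<open>small\<close> applies with tolerance \<open>t * e\<close>.
        Dividing by \<open>t\<close> afterwards turns the bound \<open>2 * real n\<close> into
        \<open>2 * real n / r * norm y\<close> and the tolerance back into \<open>e\<close>.\<close>
      define t where "t = r / norm y"
      have t: "t > 0"
        using r False by (simp add: t_def)
      have "norm (t *\<^sub>R y) \<le> r"
        using r False by (simp add: t_def)
      then obtain x v where xv: "(x, v) \<in> \<Gamma>" "norm x \<le> 2 * real n" "norm (t *\<^sub>R y - v) \<le> t * e"
        using small[of "t *\<^sub>R y" "t * e"] t e by auto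
      have "(x /\<^sub>R t, v /\<^sub>R t) \<in> \<Gamma>"
        using subspace_scale[OF assms(1) xv(1), of "inverse t"] by simp
      moreover have "norm (x /\<^sub>R t) \<le> 2 * real n / r * norm y"
        using xv(2) r False by (simp add: t_def field_simps)
      moreover have "norm (y - v /\<^sub>R t) \<le> e"
      proof -
        have "y - v /\<^sub>R t = (t *\<^sub>R y - v) /\<^sub>R t"
          using t by (simp add: scaleR_diff_right)
        then have "norm (y - v /\<^sub>R t) = norm (t *\<^sub>R y - v) / t"
          using t by (simp add: divide_inverse mult.commute)
        then show ?thesis
          using xv(3) t by (simp add: pos_divide_le_eq mult.commute)
      qed
      ultimately show ?thesis
        by blast
    qed
  qed
qed

text \<open>Corrections of geometrically decreasing size are added up: completeness of the first
  space makes the preimages summable, and closedness of \<Gamma> turns approximate solutions into an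
  exact one.\<close>

lemma closed_subspace_bounded_preimage:
  fixes \<Gamma> :: "('x::banach \<times> 'y::banach) set"
  assumes "subspace \<Gamma>" and "closed \<Gamma>" and "Range \<Gamma> = UNIV"
  obtains C where "C \<ge> 0" and "\<And>y. \<exists>x. (x, y) \<in> \<Gamma> \<and> norm x \<le> C * norm y"
proof -
  obtain K where K: "K \<ge> 0"
    and approx: "\<And>y e. e > 0 \<Longrightarrow> \<exists>x v. (x, v) \<in> \<Gamma> \<and> norm x \<le> K * norm y \<and> norm (y - v) \<le> e"
    using subspace_approximate_preimage[OF assms(1,3)] by metis
  have "\<exists>x v. (x, v) \<in> \<Gamma> \<and> norm x \<le> K * norm y \<and> norm (y - v) \<le> norm y / 2" for y
  \<comment> \<open>At 0 the tolerance \<open>norm y / 2\<close> vanishes, so \<open>approx\<close>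
    does not apply; the pair of zeros serves instead.\<close>
  proof (cases "y = 0")
    case True
    then show ?thesis
      using subspace_0[OF assms(1)] by (intro exI[of _ 0]) (auto simp: zero_prod_def)
  next
    case False
    then show ?thesis
      using approx[of "norm y / 2" y] by simp
  qed
  then obtain f g where fg: "\<And>y. (f y, g y) \<in> \<Gamma>" "\<And>y. norm (f y) \<le> K * norm y"
      "\<And>y. norm (y - g y) \<le> norm y / 2"
    by metis
  have "\<exists>x. (x, y) \<in> \<Gamma> \<and> norm x \<le> (2 * K) * norm y" for y
  proof -
    \<comment> \<open>\<open>R n\<close> is the part of \<open>y\<close> still to be reached after
      \<open>n\<close> corrections; the partial sums of \<open>g (R n)\<close> telescope to
      \<open>y - R N\<close>.\<close>
    define R where "R n = ((\<lambda>z. z - g z) ^^ n) y" for n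
    have R_Suc: "R (Suc n) = R n - g (R n)" for n
      by (simp add: R_def)
    have R_bound: "norm (R n) \<le> norm y * (1 / 2) ^ n" for n
    proof (induction n)
      case 0
      then show ?case
        by (simp add: R_def)
    next
      case (Suc n)
      then show ?case
        using fg(3)[of "R n"] by (simp add: R_Suc)
    qed
    have f_bound: "norm (f (R n)) \<le> K * norm y * (1 / 2) ^ n" for n
      using fg(2)[of "R n"] mult_left_mono[OF R_bound[of n] K] by (simp add: mult.assoc)
    \<comment> \<open>The ratio 1/2 sums to 2, which is the source of the final constant
      \<open>2 * K\<close>.\<close>
    have geo: "(\<lambda>n. K * norm y * (1 / 2) ^ n) sums (2 * K * norm y)"
      using sums_mult[OF geometric_sums[of "1 / 2 :: real"], of "K * norm y"] by (simp add: mult_ac)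
    have summ: "summable (\<lambda>n. norm (f (R n)))"
      by (rule summable_comparison_test'[OF sums_summable[OF geo]]) (simp add: f_bound)
    have "(\<Sum>n<N. g (R n)) = y - R N" for N
      by (induction N) (simp_all add: R_def)
    moreover have "R \<longlonglongrightarrow> 0"
      by (rule Lim_null_comparison[OF always_eventually[OF allI[OF R_bound]]])
        (auto intro!: tendsto_mult_right_zero LIMSEQ_realpow_zero)
    then have "(\<lambda>N. y - R N) \<longlonglongrightarrow> y - 0"
      by (intro tendsto_intros)
    ultimately have "(\<lambda>N. \<Sum>n<N. g (R n)) \<longlonglongrightarrow> y"
      by simp
    moreover have "(\<lambda>N. \<Sum>n<N. f (R n)) \<longlonglongrightarrow> (\<Sum>n. f (R n))"
      using summable_LIMSEQ summable_norm_cancel[OF summ] by blast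
    ultimately have "(\<lambda>N. (\<Sum>n<N. f (R n), \<Sum>n<N. g (R n))) \<longlonglongrightarrow> (\<Sum>n. f (R n), y)"
      by (intro tendsto_Pair)
    moreover have "(\<Sum>n<N. f (R n), \<Sum>n<N. g (R n)) \<in> \<Gamma>" for N
      using subspace_sum[OF assms(1), of "{..<N}" "\<lambda>n. (f (R n), g (R n))"] fg(1)
      by (simp add: sum_prod)
    ultimately have "(\<Sum>n. f (R n), y) \<in> \<Gamma>"
      by (rule closed_sequentially[OF assms(2), rotated])
    moreover have "norm (\<Sum>n. f (R n)) \<le> 2 * K * norm y"
      using order_trans[OF summable_norm[OF summ] suminf_le[OF f_bound summ sums_summable[OF geo]]]
        sums_unique[OF geo] by simp
    ultimately show ?thesis
      by blast
  qed
  then show thesis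
    using that[of "2 * K"] K by simp
qed

theorem theorem2:
  fixes sX :: "'k::real_normed_field \<Rightarrow> 'x::banach \<Rightarrow> 'x"
    and sY :: "'k \<Rightarrow> 'y::banach \<Rightarrow> 'y"
    and \<Gamma> :: "('x \<times> 'y) set"
    and A :: "'x set"
  assumes "normed_space_over sX"
    and "normed_space_over sY"
    and "linear_relation sX sY \<Gamma>"
    and "closed \<Gamma>"
    and "Range \<Gamma> = UNIV"
    and "open A"
  shows "open (\<Gamma> `` A)"
proof -
  have sub: "subspace \<Gamma>"
    using linear_relation_subspace[OF assms(1-3)] .
  obtain C where C: "C \<ge> 0" "\<And>y. \<exists>x. (x, y) \<in> \<Gamma> \<and> norm x \<le> C * norm y"
    using closed_subspace_bounded_preimage[OF sub assms(4,5)] by blast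
  show ?thesis
  proof (rule openI)
    fix y
    assume "y \<in> \<Gamma> `` A"
    then obtain a where a: "a \<in> A" "(a, y) \<in> \<Gamma>"
      by blast
    obtain e where e: "e > 0" "ball a e \<subseteq> A"
      using assms(6) a(1) openE by blast
    \<comment> \<open>Dividing by \<open>C + 1\<close> rather than \<open>C\<close> keeps the radius
      positive when \<open>C = 0\<close>. A point \<open>z\<close> of this ball is reached by
      correcting \<open>a\<close> with a small preimage of \<open>z - y\<close>.\<close>
    have "ball y (e / (C + 1)) \<subseteq> \<Gamma> `` A"
    proof
      fix z
      assume z: "z \<in> ball y (e / (C + 1))"
      obtain x where x: "(x, z - y) \<in> \<Gamma>" "norm x \<le> C * norm (z - y)"
        using C(2) by blast
      have "C * norm (z - y) \<le> (C + 1) * norm (z - y)"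
        by (simp add: mult_right_mono)
      also have "\<dots> < e"
        using z C(1) by (simp add: dist_norm norm_minus_commute field_simps)
      finally have "norm x < e"
        using x(2) by linarith
      then have "a + x \<in> A"
        using e(2) by (auto simp: dist_norm)
      moreover have "(a + x, z) \<in> \<Gamma>"
        using subspace_add[OF sub a(2) x(1)] by simp
      ultimately show "z \<in> \<Gamma> `` A"
        by blast
    qed
    moreover have "e / (C + 1) > 0"
      using e(1) C(1) by simp
    ultimately show "\<exists>d>0. ball y d \<subseteq> \<Gamma> `` A"
      by blast
  qed
qed

end
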